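(* Let $k\ge 1$ and let $H=[H_{ij}]_{i,j=1}^2\in \mathbb{M}_2(\mathbb{M}_k)$ be positive semidefinite. Then for every positive integer $r$, $$(\det H_{11}\,\det H_{22})^r-(\det H_{21}\,\det H_{12})^r\ \ge\ (\det H)^r .$$
   Context: $\mathbb{M}_k$ denotes the set of $k\times k$ complex matrices. $\mathbb{M}_2(\mathbb{M}_k)$ denotes the set of complex $2k\times 2k$ matrices partitioned into $2\times 2$ blocks, each block $H_{ij}$ being a $k\times k$ matrix. "Positive semidefinite" refers to $H$ as a $2k\times 2k$ complex (Hermitian) matrix. *)

theory Defs
  imports "Jordan_Normal_Form.Schur_Decomposition" "Jordan_Normal_Form.Determinant"
begin

(* The order on complex numbers is the one of HOL-Library.Complex_Order:
   x \<le> y iff Re x \<le> Re y and Im x = Im y; an inequality between complex numbers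
   thus includes that their difference is real.
   (A *\<^sub>v v) \<bullet>c v is v\<^sup>* A v, conjugation being applied to the second factor. *)
definition psd :: "nat \<Rightarrow> complex mat \<Rightarrow> bool" where
  "psd n A \<longleftrightarrow> A \<in> carrier_mat n n \<and> mat_adjoint A = A \<and>
     (\<forall>v \<in> carrier_vec n. 0 \<le> (A *\<^sub>v v) \<bullet>c v)"

end

theory Submission
  imports Defs
begin

text \<open>
  If \<open>H\<^sub>1\<^sub>1\<close> is singular, a kernel vector of it extended by zeros lies in the kernel of \<open>H\<close>, so
  \<open>det H = 0\<close> and \<open>det H\<^sub>2\<^sub>1 = 0\<close>. Otherwise put \<open>Z = H\<^sub>1\<^sub>1\<^sup>-\<^sup>1 H\<^sub>1\<^sub>2\<close>. Then \<open>H\<^sub>2\<^sub>2\<close> is the sum of the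
  positive semidefinite matrices \<open>Z\<^sup>* H\<^sub>1\<^sub>1 Z = H\<^sub>2\<^sub>1 Z\<close> and the Schur complement \<open>H\<^sub>2\<^sub>2 - H\<^sub>2\<^sub>1 Z\<close>, and
  superadditivity of the determinant on positive semidefinite matrices, multiplied by \<open>det H\<^sub>1\<^sub>1\<close>,
  gives \<open>det H + det H\<^sub>2\<^sub>1 det H\<^sub>1\<^sub>2 \<le> det H\<^sub>1\<^sub>1 det H\<^sub>2\<^sub>2\<close>, which is the case \<open>r = 1\<close>. The general
  case follows from \<open>x\<^sup>r + y\<^sup>r \<le> (x + y)\<^sup>r\<close> for \<open>x, y \<ge> 0\<close>.
\<close>

section \<open>Adjoints, including those of block matrices\<close>

lemma mat_adjoint_transpose: "mat_adjoint A = transpose_mat (map_mat conjugate A)"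
  by (rule eq_matI) (auto simp: mat_adjoint_def mat_of_rows_def)

lemma mat_adjoint_index [simp]:
  "i < dim_col A \<Longrightarrow> j < dim_row A \<Longrightarrow> mat_adjoint A $$ (i, j) = conjugate (A $$ (j, i))"
  by (simp add: mat_adjoint_transpose)

lemma mat_adjoint_dim [simp]:
  "dim_row (mat_adjoint A) = dim_col A" "dim_col (mat_adjoint A) = dim_row A"
  by (simp_all add: mat_adjoint_transpose)

lemma mat_adjoint_carrier [simp]:
  "A \<in> carrier_mat n m \<Longrightarrow> mat_adjoint A \<in> carrier_mat m n"
  by auto

lemma mat_adjoint_adjoint [simp]: "mat_adjoint (mat_adjoint A) = A"
  by (rule eq_matI) auto

lemma mat_adjoint_add:
  "A \<in> carrier_mat n m \<Longrightarrow> B \<in> carrier_mat n m \<Longrightarrow>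
    mat_adjoint (A + B) = mat_adjoint A + mat_adjoint B"
  by (rule eq_matI) (auto simp: conjugate_dist_add)

lemma mat_adjoint_minus:
  "A \<in> carrier_mat n m \<Longrightarrow> B \<in> carrier_mat n m \<Longrightarrow>
    mat_adjoint (A - B) = mat_adjoint A - mat_adjoint (B :: complex mat)"
  by (rule eq_matI) auto

lemma mat_adjoint_mult:
  fixes A B :: "'a :: conjugatable_field mat"
  assumes "A \<in> carrier_mat n m" "B \<in> carrier_mat m l"
  shows "mat_adjoint (A * B) = mat_adjoint B * mat_adjoint A"
  using assms
  by (intro eq_matI)
    (auto simp: scalar_prod_def sum_conjugate conjugate_dist_mul mult.commute intro!: sum.cong)

lemma mat_adjoint_four_block:
  assumes "A \<in> carrier_mat n m" "B \<in> carrier_mat n l" "C \<in> carrier_mat p m" "D \<in> carrier_mat p l"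
  shows "mat_adjoint (four_block_mat A B C D) =
    four_block_mat (mat_adjoint A) (mat_adjoint C) (mat_adjoint B) (mat_adjoint D)"
  using assms by (intro eq_matI) auto

lemma four_block_mat_inject:
  assumes "A \<in> carrier_mat n m" "B \<in> carrier_mat n l" "C \<in> carrier_mat p m" "D \<in> carrier_mat p l"
    and "A' \<in> carrier_mat n m" "B' \<in> carrier_mat n l" "C' \<in> carrier_mat p m" "D' \<in> carrier_mat p l"
    and eq: "four_block_mat A B C D = four_block_mat A' B' C' D'"
  shows "A = A'" "B = B'" "C = C'" "D = D'"
proof -
  have e: "four_block_mat A B C D $$ ij = four_block_mat A' B' C' D' $$ ij" for ij
    by (simp add: eq)
  note dims = assms(1-8)[THEN carrier_matD(1)] assms(1-8)[THEN carrier_matD(2)]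
  show "A = A'"
  proof (rule eq_matI)
    fix i j assume "i < dim_row A'" "j < dim_col A'"
    then show "A $$ (i, j) = A' $$ (i, j)" using e[of "(i, j)"] by (simp add: dims)
  qed (simp_all add: dims)
  show "B = B'"
  proof (rule eq_matI)
    fix i j assume "i < dim_row B'" "j < dim_col B'"
    then show "B $$ (i, j) = B' $$ (i, j)" using e[of "(i, m + j)"] by (simp add: dims)
  qed (simp_all add: dims)
  show "C = C'"
  proof (rule eq_matI)
    fix i j assume "i < dim_row C'" "j < dim_col C'"
    then show "C $$ (i, j) = C' $$ (i, j)" using e[of "(n + i, j)"] by (simp add: dims)
  qed (simp_all add: dims)
  show "D = D'"
  proof (rule eq_matI)
    fix i j assume "i < dim_row D'" "j < dim_col D'"
    then show "D $$ (i, j) = D' $$ (i, j)" using e[of "(n + i, m + j)"] by (simp add: dims)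
  qed (simp_all add: dims)
qed

text \<open>Conjugation is a ring homomorphism and so commutes with the determinant. This makes the
  product of the two off-diagonal determinants a squared modulus.\<close>

lemma det_mat_adjoint:
  fixes A :: "complex mat"
  assumes "A \<in> carrier_mat n n"
  shows "det (mat_adjoint A) = cnj (det A)"
proof -
  interpret cnj: comm_ring_hom cnj by unfold_locales auto
  show ?thesis
    using assms det_transpose[of "map_mat cnj A" n] cnj.hom_det[of A]
    by (simp add: mat_adjoint_transpose)
qed

lemma mult_mat_vec_cscalar_prod:
  fixes A :: "'a :: conjugatable_field mat"
  assumes "A \<in> carrier_mat n m" "v \<in> carrier_vec m" "w \<in> carrier_vec n"
  shows "(A *\<^sub>v v) \<bullet>c w = v \<bullet>c (mat_adjoint A *\<^sub>v w)"
proof -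
  have "(A *\<^sub>v v) \<bullet>c w = (\<Sum>i<n. \<Sum>j<m. A $$ (i, j) * v $ j * conjugate (w $ i))"
    using assms by (auto simp: scalar_prod_def sum_distrib_right lessThan_atLeast0 intro!: sum.cong)
  also have "\<dots> = (\<Sum>j<m. \<Sum>i<n. A $$ (i, j) * v $ j * conjugate (w $ i))"
    by (rule sum.swap)
  also have "\<dots> = v \<bullet>c (mat_adjoint A *\<^sub>v w)"
    using assms
    by (auto simp: scalar_prod_def sum_distrib_left lessThan_atLeast0 sum_conjugate
        conjugate_dist_mul mult_ac intro!: sum.cong)
  finally show ?thesis .
qed

section \<open>Positive semidefinite forms\<close>

lemma psd_carrier: "psd n A \<Longrightarrow> A \<in> carrier_mat n n"
  and psd_adjoint: "psd n A \<Longrightarrow> mat_adjoint A = A"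
  and psd_form_nonneg: "psd n A \<Longrightarrow> v \<in> carrier_vec n \<Longrightarrow> 0 \<le> (A *\<^sub>v v) \<bullet>c v"
  by (auto simp: psd_def)

text \<open>The form of the product at \<open>v\<close> is the form of \<open>A\<close> at
  \<open>X *\<^sub>v v\<close>, by moving the outer adjoint to the other factor.\<close>

lemma psd_congruence:
  assumes "psd n A" "X \<in> carrier_mat n m"
  shows "psd m (mat_adjoint X * A * X)"
  unfolding psd_def
proof (intro conjI ballI)
  note A = psd_carrier[OF assms(1)] and X = assms(2)
  note X' = mat_adjoint_carrier[OF X]
  show "mat_adjoint X * A * X \<in> carrier_mat m m" using A X by auto
  show "mat_adjoint (mat_adjoint X * A * X) = mat_adjoint X * A * X"
    unfolding mat_adjoint_mult[OF mult_carrier_mat[OF X' A] X] mat_adjoint_mult[OF X' A]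
    using assoc_mult_mat[OF X' A X] psd_adjoint[OF assms(1)] by simp
  fix v :: "complex vec" assume v: "v \<in> carrier_vec m"
  have "(mat_adjoint X * A * X) *\<^sub>v v = mat_adjoint X *\<^sub>v (A *\<^sub>v (X *\<^sub>v v))"
    using A X v by (simp add: assoc_mult_mat_vec[OF mult_carrier_mat[OF X' A] X v]
        assoc_mult_mat_vec[OF X' A])
  then show "0 \<le> ((mat_adjoint X * A * X) *\<^sub>v v) \<bullet>c v"
    using psd_form_nonneg[OF assms(1), of "X *\<^sub>v v"] A X v
      mult_mat_vec_cscalar_prod[OF X', of "A *\<^sub>v (X *\<^sub>v v)" v]
    by simp
qed

text \<open>Along \<open>v + t w\<close> with \<open>w = A v\<close> the form is a quadratic in
  \<open>t\<close> without constant term, so its linear coefficient, twice the squared norm of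
  \<open>w\<close>, must vanish.\<close>

lemma psd_form_zeroD:
  assumes psd: "psd n A" and v: "v \<in> carrier_vec n" and 0: "(A *\<^sub>v v) \<bullet>c v = 0"
  shows "A *\<^sub>v v = 0\<^sub>v n"
proof -
  note A = psd_carrier[OF psd]
  define w where "w = A *\<^sub>v v"
  have w: "w \<in> carrier_vec n" using A v by (simp add: w_def)
  define s where "s = Re (w \<bullet>c w)"
  define q where "q = Re ((A *\<^sub>v w) \<bullet>c w)"
  have s: "w \<bullet>c w = of_real s" 
    using conjugate_square_ge_0_vec[of w] by (simp add: s_def complex_eq_iff less_eq_complex_def)
  have q: "(A *\<^sub>v w) \<bullet>c w = of_real q" "q \<ge> 0"
    using psd_form_nonneg[OF psd w] by (simp_all add: q_def complex_eq_iff less_eq_complex_def)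
  \<comment> \<open>\<open>A\<close> is Hermitian, so it moves over to \<open>v\<close> and turns
    the cross term into the squared norm of \<open>w\<close>.\<close>
  have wv: "(A *\<^sub>v w) \<bullet>c v = of_real s"
    using mult_mat_vec_cscalar_prod[OF A w v] psd_adjoint[OF psd] s by (simp add: w_def)
  \<comment> \<open>any small negative multiple of \<open>w\<close> would make the form at \<open>?u\<close> negative, were \<open>s > 0\<close>\<close>
  define t where "t = - s / (q + 1)"
  let ?u = "v + of_real t \<cdot>\<^sub>v w"
  have "(A *\<^sub>v ?u) \<bullet>c ?u = of_real (2 * t * s + t\<^sup>2 * q)"
  proof -
    have Au: "A *\<^sub>v ?u = w + of_real t \<cdot>\<^sub>v (A *\<^sub>v w)"
      using A v w by (simp add: mult_add_distrib_mat_vec[OF A] mult_mat_vec[OF A] w_def)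
    have cu: "conjugate ?u = conjugate v + of_real t \<cdot>\<^sub>v conjugate w"
      using v w by (simp add: conjugate_add_vec[of _ n] conjugate_smult_vec)
    have Aw: "A *\<^sub>v w \<in> carrier_vec n" using A w by simp
    show ?thesis
      unfolding Au cu using v w Aw 0 s q wv
      by (simp add: add_scalar_prod_distrib[of _ n] scalar_prod_add_distrib[of _ n]
          w_def[symmetric] power2_eq_square algebra_simps)
  qed
  then have "0 \<le> 2 * t * s + t\<^sup>2 * q"
    using psd_form_nonneg[OF psd, of ?u] v w by (simp add: less_eq_complex_def)
  moreover have "2 * t * s + t\<^sup>2 * q = - (s\<^sup>2 * (q + 2)) / (q + 1)\<^sup>2"
    using q by (simp add: t_def divide_simps) (simp add: algebra_simps power2_eq_square)
  ultimately have "s\<^sup>2 * (q + 2) \<le> 0"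
    using q by (simp add: divide_simps split: if_splits)
  then have "s = 0"
    using q by (simp add: mult_le_0_iff)
  then show ?thesis
    using s w by (simp add: w_def[symmetric])
qed

section \<open>Determinants of sums of positive semidefinite matrices\<close>

lemma psd_one: "psd n (1\<^sub>m n)"
  unfolding psd_def by (auto intro!: eq_matI conjugate_square_ge_0_vec)

lemma mat_inverseE:
  fixes A :: "'a :: field mat"
  assumes "A \<in> carrier_mat n n" "det A \<noteq> 0"
  obtains B where "B \<in> carrier_mat n n" "A * B = 1\<^sub>m n" "B * A = 1\<^sub>m n"
  using det_non_zero_imp_unit[OF assms, of "()"] by (auto simp: Units_def ring_mat_simps)

text \<open>The numbers \<open>a\<close> are the eigenvalues of \<open>P\<^sup>-\<^sup>1 S\<close>; they are nonnegative because
  \<open>S v = a P v\<close> gives \<open>v\<^sup>* S v = a (v\<^sup>* P v)\<close>.\<close>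

lemma psd_pencil:
  assumes P: "psd n P" "det P \<noteq> 0" and S: "psd n S"
  shows "\<exists>as. length as = n \<and> (\<forall>a \<in> set as. 0 \<le> a) \<and>
    (\<forall>t. det (t \<cdot>\<^sub>m P + S) = det P * (\<Prod>a\<leftarrow>as. t + a))"
proof -
  note Pc = psd_carrier[OF P(1)] and Sc = psd_carrier[OF S]
  obtain Q where Q: "Q \<in> carrier_mat n n" "P * Q = 1\<^sub>m n" "Q * P = 1\<^sub>m n"
    using mat_inverseE[OF Pc P(2)] .
  \<comment> \<open>The sign makes \<open>P\<close> times \<open>t I - M\<close> equal to
    \<open>t P + S\<close>; the numbers \<open>a\<close> are then the negated roots of the
    characteristic polynomial of \<open>M\<close>.\<close>
  define M where "M = - (Q * S)"
  have M: "M \<in> carrier_mat n n" using Q Sc by (simp add: M_def)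
  obtain cs where cs: "char_poly M = (\<Prod>c\<leftarrow>cs. [:- c, 1:])" and "length cs = n"
    using char_poly_factorized[OF M] by blast
  show ?thesis
  proof (intro exI[of _ "map uminus cs"] conjI ballI allI)
    show "length (map uminus cs) = n" using \<open>length cs = n\<close> by simp
  next
    fix t :: complex
    have "P * (- char_matrix M t) = t \<cdot>\<^sub>m P + S"
    proof -
      have "- char_matrix M t = t \<cdot>\<^sub>m 1\<^sub>m n + Q * S"
        using Q Sc unfolding M_def char_matrix_def by (intro eq_matI) auto
      moreover have "P * (Q * S) = S"
        using Q Sc Pc by (simp add: assoc_mult_mat[symmetric, of _ n n _ n _ n])
      moreover have "P * (t \<cdot>\<^sub>m 1\<^sub>m n) = t \<cdot>\<^sub>m P"
        using Pc by (simp add: mult_smult_distrib[OF Pc one_carrier_mat])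
      ultimately show ?thesis
        using Q Sc mult_add_distrib_mat[OF Pc, of "t \<cdot>\<^sub>m 1\<^sub>m n" n "Q * S"] by simp
    qed
    then have "det (t \<cdot>\<^sub>m P + S) = det P * det (- char_matrix M t)"
      using det_mult[OF Pc, of "- char_matrix M t"] M by simp
    also have "det (- char_matrix M t) = poly (char_poly M) t"
      by (rule char_poly_matrix[OF M, symmetric])
    also have "\<dots> = (\<Prod>a\<leftarrow>map uminus cs. t + a)"
      unfolding cs by (induction cs) (simp_all add: left_diff_distrib)
    finally show "det (t \<cdot>\<^sub>m P + S) = det P * (\<Prod>a\<leftarrow>map uminus cs. t + a)" .
  next
    fix a assume "a \<in> set (map uminus cs)"
    then have "- a \<in> set cs" by auto
    then have "poly (char_poly M) (- a) = 0"
      unfolding cs by (rule linear_poly_root)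
    then obtain v where v: "v \<in> carrier_vec n" "v \<noteq> 0\<^sub>v n" "M *\<^sub>v v = (- a) \<cdot>\<^sub>v v"
      using M unfolding eigenvalue_root_char_poly[OF M, symmetric] eigenvalue_def eigenvector_def
      by auto
    have Sv_carrier: "S *\<^sub>v v \<in> carrier_vec n" using Sc v(1) by simp
    have "- (M *\<^sub>v v) = Q * S *\<^sub>v v"
      using Q Sc v(1) unfolding M_def by (intro eq_vecI) auto
    moreover have "- ((- a) \<cdot>\<^sub>v v) = a \<cdot>\<^sub>v v" by (intro eq_vecI) auto
    ultimately have "Q * S *\<^sub>v v = a \<cdot>\<^sub>v v"
      using v(3) by simp
    then have QSv: "Q *\<^sub>v (S *\<^sub>v v) = a \<cdot>\<^sub>v v"
      using assoc_mult_mat_vec[OF Q(1) Sc v(1)] by simp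
    have "S *\<^sub>v v = P *\<^sub>v (Q *\<^sub>v (S *\<^sub>v v))"
      using assoc_mult_mat_vec[OF Pc Q(1) Sv_carrier] Sv_carrier by (simp add: Q(2))
    also note QSv
    finally have Sv: "S *\<^sub>v v = a \<cdot>\<^sub>v (P *\<^sub>v v)"
      using Pc v by (simp add: mult_mat_vec[OF Pc])
    \<comment> \<open>Otherwise \<open>v\<close> would be a nonzero kernel vector of the nonsingular
      matrix \<open>P\<close>.\<close>
    have "(P *\<^sub>v v) \<bullet>c v \<noteq> 0"
      using psd_form_zeroD[OF P(1) v(1)] det_0_iff_vec_prod_zero[OF Pc] P(2) v by blast
    moreover have "0 \<le> (P *\<^sub>v v) \<bullet>c v" "0 \<le> a * ((P *\<^sub>v v) \<bullet>c v)"
      using psd_form_nonneg[OF P(1) v(1)] psd_form_nonneg[OF S v(1)] Sv Pc v by simp_all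
    ultimately show "0 \<le> a"
      by (auto simp: less_eq_complex_def zero_le_mult_iff complex_eq_iff)
  qed
qed

lemma prod_list_nonneg_complex:
  "(\<And>a. a \<in> set as \<Longrightarrow> (0::complex) \<le> a) \<Longrightarrow> 0 \<le> prod_list as"
  by (induction as) (auto simp: less_eq_complex_def)

text \<open>The left side keeps only two terms of the expanded product, and the others are
  nonnegative. For the empty list these two terms coincide and the claim would read 2 \<le>
  1.\<close>

lemma one_plus_prod_list_le:
  assumes "\<And>a. a \<in> set as \<Longrightarrow> (0::complex) \<le> a" "as \<noteq> []"
  shows "1 + prod_list as \<le> (\<Prod>a\<leftarrow>as. 1 + a)"
  using assms(2,1)
proof (induction as rule: list_nonempty_induct)
  case (cons a as)
  have a: "0 \<le> a" and p: "0 \<le> prod_list as"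
    using cons.prems by (auto intro: prod_list_nonneg_complex)
  have "1 + prod_list (a # as) \<le> (1 + a) * (1 + prod_list as)"
    using add_nonneg_nonneg[OF a p] by (simp add: algebra_simps)
  also have "\<dots> \<le> (1 + a) * (\<Prod>a\<leftarrow>as. 1 + a)"
    using cons a by (intro mult_left_mono) (auto simp: less_eq_complex_def)
  finally show ?case by simp
qed simp

text \<open>Taking \<open>P\<close> to be the identity and \<open>t = 0\<close> in the pencil writes
  the determinant as a product of nonnegative numbers.\<close>

lemma psd_det_nonneg:
  assumes "psd n A"
  shows "0 \<le> det A"
proof -
  have "det (1\<^sub>m n :: complex mat) \<noteq> 0" by simp
  then obtain as where as: "\<And>a. a \<in> set as \<Longrightarrow> (0::complex) \<le> a" "length as = n"
    and det: "\<And>t. det (t \<cdot>\<^sub>m 1\<^sub>m n + A) = det (1\<^sub>m n) * (\<Prod>a\<leftarrow>as. t + a)"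
    using psd_pencil[OF psd_one _ assms] by blast
  have "0 \<cdot>\<^sub>m 1\<^sub>m n + A = A"
    using psd_carrier[OF assms] by (intro eq_matI) auto
  then have "det A = prod_list as" using det[of 0] by simp
  then show ?thesis using prod_list_nonneg_complex as by simp
qed

lemma psd_add:
  assumes "psd n A" "psd n B"
  shows "psd n (A + B)"
proof -
  note A = psd_carrier[OF assms(1)] and B = psd_carrier[OF assms(2)]
  have "0 \<le> ((A + B) *\<^sub>v v) \<bullet>c v" if v: "v \<in> carrier_vec n" for v
    using psd_form_nonneg[OF assms(1) v] psd_form_nonneg[OF assms(2) v] A B v
    by (simp add: add_mult_distrib_mat_vec[of _ n n] add_scalar_prod_distrib[of _ n])
  then show ?thesis
    using A B mat_adjoint_add[OF A B] psd_adjoint[OF assms(1)] psd_adjoint[OF assms(2)]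
    by (simp add: psd_def)
qed

text \<open>The pencil at \<open>t = 0\<close> and \<open>t = 1\<close> expresses
  \<open>det S\<close> and \<open>det (P + S)\<close> through the same numbers \<open>a\<close>,
  with the common factor \<open>det P\<close>. Since \<open>n \<ge> 1\<close>, their list is
  nonempty.\<close>

lemma psd_det_add_ge_nonsingular:
  assumes P: "psd n P" "det P \<noteq> 0" and S: "psd n S" and n: "n \<ge> 1"
  shows "det P + det S \<le> det (P + S)"
proof -
  note Pc = psd_carrier[OF P(1)] and Sc = psd_carrier[OF S]
  obtain as where as: "\<And>a. a \<in> set as \<Longrightarrow> (0::complex) \<le> a" "length as = n"
    and det: "\<And>t. det (t \<cdot>\<^sub>m P + S) = det P * (\<Prod>a\<leftarrow>as. t + a)"
    using psd_pencil[OF P S] by blast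
  have "0 \<cdot>\<^sub>m P + S = S" "1 \<cdot>\<^sub>m P + S = P + S" using Pc Sc by auto
  then have "det S = det P * prod_list as" "det (P + S) = det P * (\<Prod>a\<leftarrow>as. 1 + a)"
    using det[of 0] det[of 1] by simp_all
  moreover have "1 + prod_list as \<le> (\<Prod>a\<leftarrow>as. 1 + a)"
    using as n by (intro one_plus_prod_list_le) auto
  ultimately show ?thesis
    using mult_left_mono[OF _ psd_det_nonneg[OF P(1)], of "1 + prod_list as"]
    by (simp add: distrib_left)
qed

text \<open>The claim is symmetric in \<open>P\<close> and \<open>S\<close>, so one nonsingular
  summand suffices; if both are singular, only nonnegativity of \<open>det (P + S)\<close> is left
  to show.\<close>

lemma psd_det_add_ge:
  assumes P: "psd n P" and S: "psd n S" and n: "n \<ge> 1"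
  shows "det P + det S \<le> det (P + S)"
proof -
  note Pc = psd_carrier[OF P] and Sc = psd_carrier[OF S]
  consider "det P \<noteq> 0" | "det S \<noteq> 0" | "det P = 0" "det S = 0" by blast
  then show ?thesis
  proof cases
    case 1
    then show ?thesis using psd_det_add_ge_nonsingular P S n by blast
  next
    case 2
    then show ?thesis
      using psd_det_add_ge_nonsingular[OF S _ P n] comm_add_mat[OF Pc Sc] by (simp add: add.commute)
  next
    case 3
    then show ?thesis using psd_det_nonneg[OF psd_add[OF P S]] by simp
  qed
qed

section \<open>Positive semidefinite block matrices and Schur complements\<close>

lemma mult_mat_zero_vec [simp]:
  "A \<in> carrier_mat n m \<Longrightarrow> A *\<^sub>v 0\<^sub>v m = 0\<^sub>v n"
  by (intro eq_vecI) auto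

text \<open>The adjoint relations come from comparing a Hermitian block matrix with its adjoint
  block by block; the form of \<open>A\<close> is the full form on vectors padded with
  zeros.\<close>

lemma psd_block:
  assumes A: "A \<in> carrier_mat k k" and B: "B \<in> carrier_mat k m"
    and C: "C \<in> carrier_mat m k" and D: "D \<in> carrier_mat m m"
    and H: "psd (k + m) (four_block_mat A B C D)"
  shows "psd k A" "C = mat_adjoint B" "mat_adjoint D = D"
proof -
  have "four_block_mat (mat_adjoint A) (mat_adjoint C) (mat_adjoint B) (mat_adjoint D)
      = four_block_mat A B C D"
    using mat_adjoint_four_block[OF A B C D] psd_adjoint[OF H] by simp
  note * = four_block_mat_inject[OF _ _ _ _ A B C D this]
  show "C = mat_adjoint B" "mat_adjoint D = D"
    using *(3,4) A B C D by auto
  have "0 \<le> (A *\<^sub>v v) \<bullet>c v" if v: "v \<in> carrier_vec k" for v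
  proof -
    let ?u = "v @\<^sub>v 0\<^sub>v m"
    have "four_block_mat A B C D *\<^sub>v ?u = (A *\<^sub>v v) @\<^sub>v (C *\<^sub>v v)"
      using four_block_mat_mult_vec[OF A B C D v, of "0\<^sub>v m"] A B C D v by simp
    moreover have "conjugate ?u = conjugate v @\<^sub>v 0\<^sub>v m"
      using v by (intro eq_vecI) auto
    moreover have "0 \<le> (four_block_mat A B C D *\<^sub>v ?u) \<bullet>c ?u"
      using psd_form_nonneg[OF H, of ?u] v by simp
    ultimately show ?thesis
      using A C v by (simp add: scalar_prod_append[of _ k _ m])
  qed
  then show "psd k A"
    using *(1) A B C D by (auto simp: psd_def)
qed

text \<open>At the vector with halves \<open>- Z x\<close> and \<open>x\<close>, the relation
  \<open>A * Z = B\<close> cancels the upper half of the image, and the full form reduces to that of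
  the Schur complement at \<open>x\<close>.\<close>

lemma psd_schur_complement:
  assumes A: "A \<in> carrier_mat k k" and B: "B \<in> carrier_mat k m"
    and C: "C \<in> carrier_mat m k" and D: "D \<in> carrier_mat m m"
    and H: "psd (k + m) (four_block_mat A B C D)"
    and Z: "Z \<in> carrier_mat k m" "A * Z = B"
  shows "psd m (D - C * Z)"
    and "C = mat_adjoint Z * A"
proof -
  note blocks = psd_block[OF A B C D H]
  have adjA: "mat_adjoint A = A" using psd_adjoint blocks(1) .
  show C': "C = mat_adjoint Z * A"
    using blocks(2) mat_adjoint_mult[OF A Z(1)] Z(2) adjA by simp
  have "mat_adjoint (C * Z) = C * Z"
    using psd_adjoint[OF psd_congruence[OF blocks(1) Z(1)]] C' by simp
  then have adj: "mat_adjoint (D - C * Z) = D - C * Z"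
    using mat_adjoint_minus[OF D mult_carrier_mat[OF C Z(1)]] blocks(3) by simp
  have "0 \<le> ((D - C * Z) *\<^sub>v x) \<bullet>c x" if x: "x \<in> carrier_vec m" for x
  proof -
    let ?y = "- (Z *\<^sub>v x)" and ?S = "(D - C * Z) *\<^sub>v x"
    have y: "?y \<in> carrier_vec k" using Z x by simp
    have neg: "M *\<^sub>v ?y = - (M *\<^sub>v (Z *\<^sub>v x))" if "M \<in> carrier_mat l k" for M l
      using that Z x by (intro eq_vecI) auto
    have "A *\<^sub>v ?y + B *\<^sub>v x = 0\<^sub>v k"
      unfolding neg[OF A] using A Z x by (simp add: Z(2)[symmetric] assoc_mult_mat_vec[OF A Z(1) x])
    moreover have "C *\<^sub>v ?y + D *\<^sub>v x = ?S"
      unfolding neg[OF C] using C D Z x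
      by (intro eq_vecI)
        (simp_all add: minus_mult_distrib_mat_vec[of _ m m] assoc_mult_mat_vec[OF C Z(1) x])
    ultimately have "four_block_mat A B C D *\<^sub>v (?y @\<^sub>v x) = 0\<^sub>v k @\<^sub>v ?S"
      using four_block_mat_mult_vec[OF A B C D y x] by simp
    moreover have "conjugate (?y @\<^sub>v x) = conjugate ?y @\<^sub>v conjugate x"
      using x y by (intro eq_vecI) auto
    moreover have "0 \<le> (four_block_mat A B C D *\<^sub>v (?y @\<^sub>v x)) \<bullet>c (?y @\<^sub>v x)"
      using psd_form_nonneg[OF H, of "?y @\<^sub>v x"] x y by simp
    ultimately show ?thesis
      using scalar_prod_append[of "0\<^sub>v k" k ?S m "conjugate ?y" "conjugate x"]
        minus_carrier_mat[OF mult_carrier_mat[OF C Z(1)], of D] x y by simp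
  qed
  then show "psd m (D - C * Z)"
    using adj minus_carrier_mat[OF mult_carrier_mat[OF C Z(1)]] by (auto simp: psd_def)
qed

text \<open>Block LU factorization: the left factor is lower triangular with diagonal blocks
  \<open>A\<close> and \<open>D - C * Z\<close>, the right one is upper triangular with identity
  diagonal blocks.\<close>

lemma det_four_block_schur:
  fixes A :: "'a :: idom mat"
  assumes A: "A \<in> carrier_mat k k" and B: "B \<in> carrier_mat k m"
    and C: "C \<in> carrier_mat m k" and D: "D \<in> carrier_mat m m"
    and Z: "Z \<in> carrier_mat k m" "A * Z = B"
  shows "det (four_block_mat A B C D) = det A * det (D - C * Z)"
proof -
  let ?S = "D - C * Z"
  have S: "?S \<in> carrier_mat m m" by (rule minus_carrier_mat[OF mult_carrier_mat[OF C Z(1)]])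
  have "four_block_mat A (0\<^sub>m k m) C ?S * four_block_mat (1\<^sub>m k) Z (0\<^sub>m m k) (1\<^sub>m m)
      = four_block_mat A B C (C * Z + ?S)"
    using mult_four_block_mat[OF A zero_carrier_mat C S one_carrier_mat Z(1) zero_carrier_mat one_carrier_mat]
      A B C D Z S by simp
  also have "C * Z + ?S = D"
    using C D Z by (intro eq_matI) auto
  finally have "det (four_block_mat A B C D) = det (four_block_mat A (0\<^sub>m k m) C ?S)
      * det (four_block_mat (1\<^sub>m k) Z (0\<^sub>m m k) (1\<^sub>m m))"
    using A D S by (metis det_mult four_block_carrier_mat one_carrier_mat)
  then show ?thesis
    using det_four_block_mat_upper_right_zero[OF A refl C S]
      det_four_block_mat_lower_left_zero[OF one_carrier_mat Z(1) refl one_carrier_mat] by simp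
qed

lemma psd_block_det_singular:
  assumes A: "A \<in> carrier_mat k k" and B: "B \<in> carrier_mat k k"
    and C: "C \<in> carrier_mat k k" and D: "D \<in> carrier_mat k k"
    and H: "psd (k + k) (four_block_mat A B C D)"
    and "det A = 0"
  shows "det (four_block_mat A B C D) = 0" "det C = 0"
proof -
  obtain v where v: "v \<in> carrier_vec k" "v \<noteq> 0\<^sub>v k" "A *\<^sub>v v = 0\<^sub>v k"
    using det_0_iff_vec_prod_zero[OF A] assms(6) by blast
  let ?u = "v @\<^sub>v 0\<^sub>v k"
  have u: "?u \<in> carrier_vec (k + k)" using v by simp
  have Hu: "four_block_mat A B C D *\<^sub>v ?u = 0\<^sub>v k @\<^sub>v (C *\<^sub>v v)"
    using four_block_mat_mult_vec[OF A B C D v(1), of "0\<^sub>v k"] A B C D v by simp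
  have "conjugate ?u = conjugate v @\<^sub>v 0\<^sub>v k"
    using v by (intro eq_vecI) auto
  \<comment> \<open>The upper half of the image is \<open>A v = 0\<close>, and its lower half meets
    the zero half of \<open>?u\<close>.\<close>
  then have "(four_block_mat A B C D *\<^sub>v ?u) \<bullet>c ?u = 0"
    unfolding Hu using C v by (simp add: scalar_prod_append[of _ k _ k])
  then have 0: "four_block_mat A B C D *\<^sub>v ?u = 0\<^sub>v (k + k)"
    by (rule psd_form_zeroD[OF H u])
  have split: "0\<^sub>v (k + k) = 0\<^sub>v k @\<^sub>v 0\<^sub>v k" by (intro eq_vecI) auto
  have "?u \<noteq> 0\<^sub>v (k + k)"
    unfolding split using v append_vec_eq[of v k "0\<^sub>v k"] by simp
  then show "det (four_block_mat A B C D) = 0"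
    using det_0_iff_vec_prod_zero[OF psd_carrier[OF H]] u 0 by blast
  have "C *\<^sub>v v = 0\<^sub>v k"
    using 0 unfolding Hu split by (simp add: append_vec_eq[of _ k])
  then show "det C = 0"
    using det_0_iff_vec_prod_zero[OF C] v by blast
qed

lemma psd_block_det_le:
  assumes A: "A \<in> carrier_mat k k" and B: "B \<in> carrier_mat k k"
    and C: "C \<in> carrier_mat k k" and D: "D \<in> carrier_mat k k"
    and H: "psd (k + k) (four_block_mat A B C D)" and k: "k \<ge> 1"
  shows "det (four_block_mat A B C D) + det C * det B \<le> det A * det D"
proof (cases "det A = 0")
  case True
  then show ?thesis using psd_block_det_singular[OF A B C D H] by simp
next
  case False
  obtain Q where Q: "Q \<in> carrier_mat k k" "A * Q = 1\<^sub>m k"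
    using mat_inverseE[OF A False] .
  define Z where "Z = Q * B"
  have Z: "Z \<in> carrier_mat k k" "A * Z = B"
    using A B Q assoc_mult_mat[OF A Q(1) B] by (simp_all add: Z_def)
  note psdA = psd_block(1)[OF A B C D H] and S = psd_schur_complement[OF A B C D H Z]
  \<comment> \<open>Because \<open>C = mat_adjoint Z * A\<close>, this product is a congruence
    transform of \<open>A\<close>.\<close>
  have P: "psd k (C * Z)" using psd_congruence[OF psdA Z(1)] S(2) by simp
  have "det B = det A * det Z" using det_mult[OF A Z(1)] Z(2) by simp
  moreover have "det (C * Z) = det C * det Z" using det_mult[OF C Z(1)] .
  moreover have "C * Z + (D - C * Z) = D"
    using C D Z by (intro eq_matI) auto
  then have "det (C * Z) + det (D - C * Z) \<le> det D"
    using psd_det_add_ge[OF P S(1) k] by simp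
  \<comment> \<open>The factor \<open>det A\<close> turns \<open>det (C * Z)\<close> into
    \<open>det C * det B\<close>, as \<open>det B = det A * det Z\<close>, and the determinant of
    the Schur complement into that of the whole matrix.\<close>
  then have "det A * (det (C * Z) + det (D - C * Z)) \<le> det A * det D"
    by (rule mult_left_mono[OF _ psd_det_nonneg[OF psdA]])
  ultimately show ?thesis
    using det_four_block_schur[OF A B C D Z] by (simp add: algebra_simps)
qed

section \<open>Passage to the power \<open>r\<close>\<close>

lemma power_add_le_add_power:
  fixes x y :: "'a :: linordered_semidom"
  assumes "0 \<le> x" "0 \<le> y" "r \<ge> 1"
  shows "x ^ r + y ^ r \<le> (x + y) ^ r"
  using assms(3)
proof (induction r rule: dec_induct)
  case (step r)
  \<comment> \<open>The added summands are the mixed terms of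
    \<open>(x + y) * (x ^ r + y ^ r)\<close>.\<close>
  have "x ^ Suc r + y ^ Suc r \<le> x ^ Suc r + y ^ Suc r + (x * y ^ r + y * x ^ r)"
    using assms by simp
  also have "\<dots> = (x + y) * (x ^ r + y ^ r)"
    by (simp add: algebra_simps)
  also have "\<dots> \<le> (x + y) * (x + y) ^ r"
    using step.IH assms by (intro mult_left_mono) auto
  finally show ?case by simp
qed simp

text \<open>In the order on complex numbers the hypotheses force \<open>x\<close>, \<open>y\<close>
  and \<open>z\<close> to be real, so the real inequality and monotonicity of powers apply.\<close>

lemma complex_power_add_le_power:
  fixes x y z :: complex
  assumes "0 \<le> x" "0 \<le> y" "x + y \<le> z" "r \<ge> 1"
  shows "x ^ r + y ^ r \<le> z ^ r"
proof -
  define a b c where "a = Re x" and "b = Re y" and "c = Re z"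
  have xyz: "x = of_real a" "y = of_real b" "z = of_real c" and "0 \<le> a" "0 \<le> b" "a + b \<le> c"
    using assms by (auto simp: a_def b_def c_def less_eq_complex_def complex_eq_iff)
  have "a ^ r + b ^ r \<le> (a + b) ^ r"
    using power_add_le_add_power \<open>0 \<le> a\<close> \<open>0 \<le> b\<close> assms(4) .
  also have "\<dots> \<le> c ^ r"
    using \<open>0 \<le> a\<close> \<open>0 \<le> b\<close> \<open>a + b \<le> c\<close> by (intro power_mono) auto
  finally have "a ^ r + b ^ r \<le> c ^ r" .
  then show ?thesis
    unfolding xyz of_real_power[symmetric] of_real_add[symmetric]
    by (simp add: less_eq_complex_def del: of_real_add of_real_power)
qed

theorem corollary4p2:
  fixes k r :: nat
    and H H11 H12 H21 H22 :: "complex mat"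
  assumes "k \<ge> 1"
    and "H11 \<in> carrier_mat k k" "H12 \<in> carrier_mat k k"
    and "H21 \<in> carrier_mat k k" "H22 \<in> carrier_mat k k"
    and "H = four_block_mat H11 H12 H21 H22"
    and "psd (2 * k) H"
    and "r \<ge> 1"
  shows "(det H11 * det H22) ^ r - (det H21 * det H12) ^ r \<ge> (det H) ^ r"
proof -
  have psd: "psd (k + k) (four_block_mat H11 H12 H21 H22)"
    using assms(6,7) by (simp add: mult_2)
  \<comment> \<open>Being adjoint to each other, the off-diagonal blocks have conjugate
    determinants, whose product is real and nonnegative.\<close>
  have "det H21 = cnj (det H12)"
    using psd_block(2)[OF assms(2-5) psd] det_mat_adjoint[OF assms(3)] by simp
  then have "0 \<le> det H21 * det H12"
    using conjugate_square_positive[of "det H12"] by (simp add: mult.commute)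
  moreover have "0 \<le> det H" using psd_det_nonneg[OF assms(7)] .
  moreover have "det H + det H21 * det H12 \<le> det H11 * det H22"
    using psd_block_det_le[OF assms(2-5) psd assms(1)] assms(6) by simp
  ultimately have "det H ^ r + (det H21 * det H12) ^ r \<le> (det H11 * det H22) ^ r"
    using complex_power_add_le_power assms(8) by blast
  then show ?thesis by (simp add: le_diff_eq)
qed

end
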